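(* Let $\varrho^{B}$ be a state on the Hilbert space $\mathbb{C}^d\otimes\mathbb{C}^d$ that is diagonal in a maximally entangled basis. Then $$\mathcal{M}(\varrho^{B})\geq \log_2 d-S(\varrho^{B})=I_{coh}(\varrho^{B}).$$
   Context: A state is a density matrix; $S(\varrho)=-\mathrm{Tr}\,\varrho\log_2\varrho$ is the von Neumann entropy. A maximally entangled basis is an orthonormal basis of $\mathbb{C}^d\otimes\mathbb{C}^d$ all of whose vectors are maximally entangled (all $d$ Schmidt coefficients equal to $1/\sqrt d$). The coherent information $I_{coh}(\varrho)$ is the difference between the von Neumann entropy of a subsystem (the reduced state of $\varrho$) and the von Neumann entropy of the entire state. $\mathcal{PS}$ denotes the set of product states $\varrho_A\otimes\varrho_B$. A von Neumann measurement $\mathcal{P}=\{P_i\}$ is a complete family of mutually orthogonal rank-one projectors on $\mathbb{C}^d\otimes\mathbb{C}^d$ (not necessarily of product form) summing to the identity. The Klein entropy is $H(\varrho,\mathcal{P})=-\sum_i p_i\log_2 p_i$ with $p_i=\mathrm{Tr}(\varrho P_i)$ and $0\log_2 0=0$. The entropic entanglement parameter is $$\mathcal{M}(\varrho)=\sup_{\mathcal{P}}\Big(\inf_{\delta\in\mathcal{PS}}H(\delta,\mathcal{P})-H(\varrho,\mathcal{P})\Big),$$ the supremum being over all von Neumann measurements. *)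

theory Defs
  imports "HOL-Analysis.Analysis"
begin

text \<open>
  The space \<open>\<complex>\<^sup>d\<close> is rendered as \<^typ>\<open>complex ^ 'n\<close> with \<open>d = CARD('n)\<close>, and the tensor product of
  two copies of it as \<^typ>\<open>complex ^ ('n::finite \<times> 'n)\<close>: the coordinate \<open>(i, j)\<close> belongs to the
  product vector of the standard basis vectors \<open>i\<close> and \<open>j\<close>.
\<close>

definition cinner :: "complex ^ 'm::finite \<Rightarrow> complex ^ 'm \<Rightarrow> complex" where
  "cinner v w = (\<Sum>i\<in>UNIV. cnj (v $ i) * w $ i)"

definition hermitian :: "complex ^ 'm ^ 'm::finite \<Rightarrow> bool" where
  "hermitian A \<longleftrightarrow> (\<forall>i j. A $ i $ j = cnj (A $ j $ i))"

definition density_matrix :: "complex ^ 'm ^ 'm::finite \<Rightarrow> bool" where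
  "density_matrix \<rho> \<longleftrightarrow>
     hermitian \<rho> \<and> (\<forall>v. 0 \<le> Re (cinner v (\<rho> *v v))) \<and> trace \<rho> = 1"

definition orthonormal_basis :: "('m::finite \<Rightarrow> complex ^ 'm) \<Rightarrow> bool" where
  "orthonormal_basis b \<longleftrightarrow>
     (\<forall>i j. cinner (b i) (b j) = (if i = j then 1 else 0)) \<and> vec.span (range b) = UNIV"

definition diagonal_in :: "('m::finite \<Rightarrow> complex ^ 'm) \<Rightarrow> complex ^ 'm ^ 'm \<Rightarrow> bool" where
  "diagonal_in b A \<longleftrightarrow> (\<forall>i j. i \<noteq> j \<longrightarrow> cinner (b i) (A *v b j) = 0)"

text \<open>
  Functional calculus: \<open>herm_fun f A\<close> is the matrix that acts as the scalar \<open>f x\<close> on the eigenspace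
  of \<open>A\<close> for each (real) eigenvalue \<open>x\<close>. By the spectral theorem it exists and is unique for every
  Hermitian \<open>A\<close>; its value is unspecified for matrices that are not diagonalizable with real
  eigenvalues.
\<close>

definition herm_fun :: "(real \<Rightarrow> real) \<Rightarrow> complex ^ 'm ^ 'm::finite \<Rightarrow> complex ^ 'm ^ 'm" where
  "herm_fun f A = (THE F. \<forall>x v. A *v v = complex_of_real x *s v \<longrightarrow>
                                F *v v = complex_of_real (f x) *s v)"

text \<open>
  Since \<open>log 2 0 = 0\<close> in HOL, the kernel of \<open>\<rho>\<close> contributes nothing to the trace below, and the
  convention \<open>0 log 0 = 0\<close> also holds in \<open>klein_entropy\<close>.
\<close>

definition von_neumann_entropy :: "complex ^ 'm ^ 'm::finite \<Rightarrow> real" where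
  "von_neumann_entropy \<rho> = - Re (trace (\<rho> ** herm_fun (log 2) \<rho>))"

definition tensor_vec ::
  "complex ^ 'n::finite \<Rightarrow> complex ^ 'n \<Rightarrow> complex ^ ('n \<times> 'n)" where
  "tensor_vec v w = (\<chi> p. v $ fst p * w $ snd p)"

definition tensor_mat ::
  "complex ^ 'n ^ 'n::finite \<Rightarrow> complex ^ 'n ^ 'n \<Rightarrow> complex ^ ('n \<times> 'n) ^ ('n \<times> 'n)" where
  "tensor_mat A B = (\<chi> p q. A $ fst p $ fst q * B $ snd p $ snd q)"

definition product_states :: "(complex ^ ('n \<times> 'n) ^ ('n::finite \<times> 'n)) set" where
  "product_states = {tensor_mat A B | A B. density_matrix A \<and> density_matrix B}"

definition reduced_A ::
  "complex ^ ('n \<times> 'n) ^ ('n::finite \<times> 'n) \<Rightarrow> complex ^ 'n ^ 'n" where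
  "reduced_A \<rho> = (\<chi> i j. \<Sum>k\<in>UNIV. \<rho> $ (i, k) $ (j, k))"

definition reduced_B ::
  "complex ^ ('n \<times> 'n) ^ ('n::finite \<times> 'n) \<Rightarrow> complex ^ 'n ^ 'n" where
  "reduced_B \<rho> = (\<chi> i j. \<Sum>k\<in>UNIV. \<rho> $ (k, i) $ (k, j))"

definition coherent_information_A :: "complex ^ ('n \<times> 'n) ^ ('n::finite \<times> 'n) \<Rightarrow> real" where
  "coherent_information_A \<rho> = von_neumann_entropy (reduced_A \<rho>) - von_neumann_entropy \<rho>"

definition coherent_information_B :: "complex ^ ('n \<times> 'n) ^ ('n::finite \<times> 'n) \<Rightarrow> real" where
  "coherent_information_B \<rho> = von_neumann_entropy (reduced_B \<rho>) - von_neumann_entropy \<rho>"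

definition schmidt_decomposition ::
  "complex ^ ('n::finite \<times> 'n) \<Rightarrow> ('n \<Rightarrow> real) \<Rightarrow>
     ('n \<Rightarrow> complex ^ 'n) \<Rightarrow> ('n \<Rightarrow> complex ^ 'n) \<Rightarrow> bool" where
  "schmidt_decomposition \<psi> s e f \<longleftrightarrow>
     orthonormal_basis e \<and> orthonormal_basis f \<and> (\<forall>i. 0 \<le> s i) \<and>
     \<psi> = (\<Sum>i\<in>UNIV. complex_of_real (s i) *s tensor_vec (e i) (f i))"

definition maximally_entangled :: "complex ^ ('n::finite \<times> 'n) \<Rightarrow> bool" where
  "maximally_entangled \<psi> \<longleftrightarrow>
     (\<exists>e f. schmidt_decomposition \<psi> (\<lambda>_. 1 / sqrt (real CARD('n))) e f)"

definition maximally_entangled_basis ::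
  "('n::finite \<times> 'n \<Rightarrow> complex ^ ('n \<times> 'n)) \<Rightarrow> bool" where
  "maximally_entangled_basis b \<longleftrightarrow> orthonormal_basis b \<and> (\<forall>i. maximally_entangled (b i))"

text \<open>
  A complete family of mutually orthogonal rank-one projectors has as many members as the dimension
  of the space, so the index type of the coordinates can also label the outcomes.
\<close>

definition von_neumann_measurement :: "('m::finite \<Rightarrow> complex ^ 'm ^ 'm) \<Rightarrow> bool" where
  "von_neumann_measurement P \<longleftrightarrow>
     (\<forall>i. hermitian (P i) \<and> P i ** P i = P i \<and> rank (P i) = 1) \<and>
     (\<forall>i j. i \<noteq> j \<longrightarrow> P i ** P j = 0) \<and>
     (\<Sum>i\<in>UNIV. P i) = mat 1"

definition klein_entropy ::
  "complex ^ 'm ^ 'm::finite \<Rightarrow> ('m \<Rightarrow> complex ^ 'm ^ 'm) \<Rightarrow> real" where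
  "klein_entropy \<rho> P =
     - (\<Sum>i\<in>UNIV. Re (trace (\<rho> ** P i)) * log 2 (Re (trace (\<rho> ** P i))))"

text \<open>
  For states, \<open>klein_entropy\<close> lies between \<open>0\<close> and \<open>2 * log 2 d\<close>, so the infimum and the supremum
  below are taken over nonempty bounded sets of reals.
\<close>

definition entropic_entanglement :: "complex ^ ('n \<times> 'n) ^ ('n::finite \<times> 'n) \<Rightarrow> real" where
  "entropic_entanglement \<rho> =
     (SUP P\<in>{P. von_neumann_measurement P}.
        (INF \<delta>\<in>product_states. klein_entropy \<delta> P) - klein_entropy \<rho> P)"

end

theory Submission
  imports Defs
begin

text \<open>
  Measure in the basis \<open>b\<close> itself: the outcome probabilities of \<open>\<rho>\<close> are its eigenvalues, so the
  Klein entropy of \<open>\<rho>\<close> is its von Neumann entropy. For a maximally entangled \<open>\<psi>\<close> with Schmidt bases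
  \<open>e\<close>, \<open>f\<close>, the probability of \<open>\<psi>\<close> in \<open>A \<otimes> B\<close> is \<open>(1/d) \<Sum>\<^sub>k\<^sub>l A\<^sub>k\<^sub>l B\<^sub>k\<^sub>l\<close>, with \<open>A\<close> written in \<open>e\<close> and
  \<open>B\<close> in \<open>f\<close>; it is at most \<open>1/d\<close> because the Frobenius norm of a positive semidefinite matrix is at
  most its trace. Hence every product state has Klein entropy at least \<open>log 2 d\<close>. The marginals of
  \<open>\<rho>\<close> are mixtures of those of the basis vectors, all equal to \<open>1/d\<close> times the identity.
\<close>

subsection \<open>Inner products and rank-one matrices\<close>

text \<open>The operator written |v><w| in Dirac notation; for a unit vector \<open>v\<close>,
  \<open>outer v v\<close> is the projector onto its line.\<close>

definition outer :: "complex ^ 'm::finite \<Rightarrow> complex ^ 'm \<Rightarrow> complex ^ 'm ^ 'm" where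
  "outer v w = (\<chi> i j. v $ i * cnj (w $ j))"

lemma cinner_zero_left [simp]: "cinner 0 w = 0"
  and cinner_zero_right [simp]: "cinner v 0 = 0"
  by (simp_all add: cinner_def)

lemma cinner_add_left: "cinner (u + v) w = cinner u w + cinner v w"
  and cinner_add_right: "cinner u (v + w) = cinner u v + cinner u w"
  by (simp_all add: cinner_def algebra_simps sum.distrib)

lemma cinner_diff_left: "cinner (u - v) w = cinner u w - cinner v w"
  and cinner_diff_right: "cinner u (v - w) = cinner u v - cinner u w"
  by (simp_all add: cinner_def algebra_simps sum_subtractf)

lemma cinner_scale_left: "cinner (c *s v) w = cnj c * cinner v w"
  and cinner_scale_right: "cinner v (c *s w) = c * cinner v w"
  by (simp_all add: cinner_def algebra_simps sum_distrib_left)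

lemma cinner_sum_left: "cinner (\<Sum>k\<in>S. f k) w = (\<Sum>k\<in>S. cinner (f k) w)"
  by (induction S rule: infinite_finite_induct) (simp_all add: cinner_add_left)

lemma cinner_sum_right: "cinner v (\<Sum>k\<in>S. f k) = (\<Sum>k\<in>S. cinner v (f k))"
  by (induction S rule: infinite_finite_induct) (simp_all add: cinner_add_right)

lemma cnj_cinner: "cnj (cinner v w) = cinner w v"
  by (simp add: cinner_def mult.commute)

lemma cinner_axis: "cinner (axis i 1) v = v $ i"
proof -
  have "cinner (axis i 1) v = (\<Sum>k\<in>UNIV. if k = i then v $ k else 0)"
    unfolding cinner_def by (intro sum.cong) (auto simp: axis_def)
  then show ?thesis by simp
qed

lemma matrix_vector_mult_axis: "(A *v axis j 1) $ i = (A $ i $ j :: complex)"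
proof -
  have "(A *v axis j 1) $ i = (\<Sum>k\<in>UNIV. if k = j then A $ i $ k else 0)"
    unfolding matrix_vector_mult_def vec_lambda_beta by (intro sum.cong) (auto simp: axis_def)
  then show ?thesis by simp
qed

lemma cinner_axis_mult_axis: "cinner (axis i 1) (A *v axis j 1) = A $ i $ j"
  by (simp add: cinner_axis matrix_vector_mult_axis)

lemma matrix_vector_mult_scale: "A *v (c *s v) = c *s (A *v (v :: complex ^ 'm))"
  by (simp add: vec_eq_iff matrix_vector_mult_def sum_distrib_left algebra_simps)

lemma matrix_vector_mult_sum_right:
  "A *v (\<Sum>k\<in>S. f k) = (\<Sum>k\<in>S. A *v (f k :: complex ^ 'm))"
  by (induction S rule: infinite_finite_induct) (simp_all add: matrix_vector_right_distrib)

lemma matrix_vector_mult_sum_left: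
  "(\<Sum>k\<in>S. F k) *v v = (\<Sum>k\<in>S. F k *v (v :: complex ^ 'm))"
  by (induction S rule: infinite_finite_induct) (simp_all add: matrix_vector_mult_add_rdistrib)

lemma outer_mult_vector: "outer v w *v x = cinner w x *s v"
  by (simp add: vec_eq_iff outer_def matrix_vector_mult_def cinner_def sum_distrib_left
      algebra_simps)

text \<open>The scalar \<open>cinner v w\<close> is applied entrywise because \<open>*s\<close> on a
  matrix would take a row, not a number, as its scalar.\<close>

lemma outer_mult_outer: "outer u v ** outer w x = (\<chi> i j. cinner v w * outer u x $ i $ j)"
  by (simp add: vec_eq_iff outer_def matrix_matrix_mult_def cinner_def sum_distrib_left
      sum_distrib_right algebra_simps)

text \<open>Turns outcome probabilities of rank-one projectors into quadratic forms.\<close>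

lemma trace_mult_outer: "trace (A ** outer v w) = cinner w (A *v v)"
  unfolding trace_def matrix_matrix_mult_def outer_def cinner_def matrix_vector_mult_def
  by (simp add: sum_distrib_left algebra_simps)

lemma cinner_outer: "cinner v (outer u u *v v) = of_real ((cmod (cinner u v))\<^sup>2)"
  unfolding outer_mult_vector cinner_scale_right complex_norm_square cnj_cinner ..

lemma hermitian_outer: "hermitian (outer v v)"
  by (simp add: hermitian_def outer_def mult.commute)

lemma hermitian_cnj: "hermitian A \<Longrightarrow> cnj (A $ i $ j) = A $ j $ i"
  unfolding hermitian_def by metis

lemma cinner_hermitian:
  assumes "hermitian A"
  shows "cinner (A *v v) w = cinner v (A *v w)"
proof -
  have "cinner (A *v v) w = (\<Sum>i\<in>UNIV. \<Sum>j\<in>UNIV. cnj (A $ i $ j) * cnj (v $ j) * w $ i)"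
    by (simp add: cinner_def matrix_vector_mult_def sum_distrib_right)
  also have "\<dots> = (\<Sum>j\<in>UNIV. \<Sum>i\<in>UNIV. cnj (A $ i $ j) * cnj (v $ j) * w $ i)"
    by (rule sum.swap)
  also have "\<dots> = (\<Sum>j\<in>UNIV. \<Sum>i\<in>UNIV. cnj (v $ j) * (A $ j $ i * w $ i))"
    by (simp add: hermitian_cnj[OF assms] ac_simps)
  also have "\<dots> = cinner v (A *v w)"
    by (simp add: cinner_def matrix_vector_mult_def sum_distrib_left)
  finally show ?thesis .
qed

lemma cinner_hermitian_real:
  assumes "hermitian A"
  shows "cinner v (A *v v) = of_real (Re (cinner v (A *v v)))"
proof -
  have "cnj (cinner v (A *v v)) = cinner v (A *v v)"
    by (simp only: cnj_cinner cinner_hermitian[OF assms])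
  then have "cinner v (A *v v) \<in> \<real>"
    by (simp add: Reals_cnj_iff)
  then show ?thesis by (metis of_real_Re)
qed

subsection \<open>Orthonormal bases\<close>

lemma orthonormal_basis_cinner:
  "orthonormal_basis b \<Longrightarrow> cinner (b i) (b j) = (if i = j then 1 else 0)"
  by (simp add: orthonormal_basis_def)

text \<open>Orthonormality says that the matrix with columns \<open>b k\<close> has its adjoint as a
  left inverse. For square matrices a left inverse is also a right inverse, and this is the
  completeness relation.\<close>

lemma orthonormal_basis_completeness:
  fixes b :: "'m::finite \<Rightarrow> complex ^ 'm"
  assumes "orthonormal_basis b"
  shows "(\<Sum>k\<in>UNIV. b k $ i * cnj (b k $ j)) = (if i = j then 1 else 0)"
proof -
  define V where "V = (\<chi> i k. b k $ i)"
  define W where "W = (\<chi> k i. cnj (b k $ i))"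
  have "W ** V = mat 1"
    using assms
    by (simp add: vec_eq_iff V_def W_def matrix_matrix_mult_def mat_def orthonormal_basis_def
        cinner_def)
  then have "V ** W = mat 1"
    by (simp add: matrix_left_right_inverse)
  then have "(V ** W) $ i $ j = mat 1 $ i $ j"
    by simp
  then show ?thesis
    by (simp add: V_def W_def matrix_matrix_mult_def mat_def)
qed

lemma sum_outer_orthonormal_basis:
  "orthonormal_basis b \<Longrightarrow> (\<Sum>k\<in>UNIV. outer (b k) (b k)) = mat 1"
  by (simp add: vec_eq_iff outer_def mat_def orthonormal_basis_completeness)

lemma orthonormal_basis_expansion:
  assumes "orthonormal_basis b"
  shows "(\<Sum>k\<in>UNIV. cinner (b k) v *s b k) = v"
proof -
  have "(\<Sum>k\<in>UNIV. cinner (b k) v *s b k) = (\<Sum>k\<in>UNIV. outer (b k) (b k)) *v v"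
    by (simp add: matrix_vector_mult_sum_left outer_mult_vector)
  then show ?thesis
    using assms by (simp add: sum_outer_orthonormal_basis)
qed

lemma matrix_eqI_on_orthonormal_basis:
  fixes A B :: "complex ^ 'm ^ 'm::finite"
  assumes "orthonormal_basis b" and "\<And>i. A *v b i = B *v b i"
  shows "A = B"
proof -
  have "A *v v = B *v v" for v
  proof -
    have "A *v (\<Sum>k\<in>UNIV. cinner (b k) v *s b k) = B *v (\<Sum>k\<in>UNIV. cinner (b k) v *s b k)"
      by (simp add: matrix_vector_mult_sum_right matrix_vector_mult_scale assms(2))
    then show ?thesis
      by (simp only: orthonormal_basis_expansion[OF assms(1)])
  qed
  then show ?thesis by (simp add: matrix_eq)
qed

lemma orthonormal_basis_axis: "orthonormal_basis (\<lambda>i. axis i 1 :: complex ^ 'm::finite)"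
proof -
  have o: "cinner (axis i 1) (axis j 1 :: complex ^ 'm) = (if i = j then 1 else 0)" for i j
    by (simp add: cinner_axis) (simp add: axis_def)
  have "v \<in> vec.span (range (\<lambda>i. axis i 1))" for v :: "complex ^ 'm"
  proof -
    have "v = (\<Sum>i\<in>UNIV. v $ i *s axis i 1)"
      by (simp add: basis_expansion)
    also have "\<dots> \<in> vec.span (range (\<lambda>i. axis i 1))"
      by (intro vec.span_sum vec.span_scale vec.span_base) auto
    finally show ?thesis .
  qed
  then show ?thesis
    unfolding orthonormal_basis_def using o by blast
qed

lemma matrix_mult_sum_right:
  fixes A :: "complex ^ 'm ^ 'm::finite"
  shows "A ** (\<Sum>k\<in>S. F k) = (\<Sum>k\<in>S. A ** F k)"
  by (simp add: vec_eq_iff matrix_matrix_mult_def sum_distrib_left) (intro allI sum.swap)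

lemma trace_sum:
  fixes F :: "'k \<Rightarrow> complex ^ 'm ^ 'm::finite"
  shows "trace (\<Sum>k\<in>S. F k) = (\<Sum>k\<in>S. trace (F k))"
  unfolding trace_def sum_component by (rule sum.swap)

lemma trace_orthonormal_basis:
  assumes "orthonormal_basis b"
  shows "trace A = (\<Sum>k\<in>UNIV. cinner (b k) (A *v b k))"
proof -
  have "trace A = trace (A ** (\<Sum>k\<in>UNIV. outer (b k) (b k)))"
    using assms by (simp add: sum_outer_orthonormal_basis)
  then show ?thesis
    by (simp add: matrix_mult_sum_right trace_sum trace_mult_outer)
qed

subsection \<open>Entropies and eigenbases\<close>

text \<open>The spectral sum \<open>F\<close> meets the condition in \<open>herm_fun\<close> for
  every eigenvector, including mixtures inside a degenerate eigenspace, and values on the basis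
  \<open>b\<close> determine a matrix. Hence the description in \<open>herm_fun\<close> picks out
  \<open>F\<close>.\<close>

lemma herm_fun_eigenbasis:
  fixes A :: "complex ^ 'm ^ 'm::finite"
  assumes b: "orthonormal_basis b" and eig: "\<And>i. A *v b i = of_real (l i) *s b i"
  shows "herm_fun f A *v b i = of_real (f (l i)) *s b i"
proof -
  define F where "F = (\<Sum>k\<in>UNIV. outer (of_real (f (l k)) *s b k) (b k))"
  have Fv: "F *v v = (\<Sum>k\<in>UNIV. (cinner (b k) v * of_real (f (l k))) *s b k)" for v
    by (simp add: F_def matrix_vector_mult_sum_left outer_mult_vector)
  have ev: "F *v v = of_real (f x) *s v" if "A *v v = of_real x *s v" for x v
  proof -
    \<comment> \<open>Comparing coefficients along \<open>b k\<close> in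
      \<open>A *v v = of_real x *s v\<close> shows that \<open>v\<close> has a component there only
      if \<open>l k = x\<close>.\<close>
    have *: "cinner (b k) v * of_real (f (l k)) = of_real (f x) * cinner (b k) v" for k
    proof -
      have "cinner (b k) (A *v v) =
          (\<Sum>j\<in>UNIV. if k = j then cinner (b j) v * of_real (l j) else 0)"
        apply (subst orthonormal_basis_expansion[OF b, of v, symmetric])
        unfolding matrix_vector_mult_sum_right matrix_vector_mult_scale eig cinner_sum_right
          cinner_scale_right
        by (intro sum.cong) (auto simp: orthonormal_basis_cinner[OF b])
      also have "\<dots> = cinner (b k) v * of_real (l k)" by simp
      finally have "cinner (b k) v * of_real (l k) = of_real x * cinner (b k) v"
        unfolding that cinner_scale_right by (rule sym)
      then have "cinner (b k) v = 0 \<or> l k = x"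
        by simp
      then show ?thesis by auto
    qed
    have "F *v v = of_real (f x) *s (\<Sum>k\<in>UNIV. cinner (b k) v *s b k)"
      unfolding Fv * by (simp add: vec.scale_sum_right)
    then show ?thesis
      using orthonormal_basis_expansion[OF b] by simp
  qed
  have "herm_fun f A = F"
    unfolding herm_fun_def
  proof (rule the_equality)
    fix G
    assume "\<forall>x v. A *v v = of_real x *s v \<longrightarrow> G *v v = of_real (f x) *s v"
    then have "G *v b i = of_real (f (l i)) *s b i" for i
      using eig[of i] by simp
    then show "G = F"
      using ev[OF eig] by (intro matrix_eqI_on_orthonormal_basis[OF b]) simp
  qed (simp add: ev)
  then show ?thesis using ev[OF eig] by simp
qed

lemma von_neumann_entropy_eigenbasis:
  assumes b: "orthonormal_basis b" and eig: "\<And>i. A *v b i = of_real (l i) *s b i"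
  shows "von_neumann_entropy A = - (\<Sum>i\<in>UNIV. l i * log 2 (l i))"
proof -
  have "(A ** herm_fun (log 2) A) *v b i = of_real (l i * log 2 (l i)) *s b i" for i
    unfolding matrix_vector_mul_assoc[symmetric] herm_fun_eigenbasis[OF assms]
      matrix_vector_mult_scale eig
    by (simp add: mult.commute)
  then have "trace (A ** herm_fun (log 2) A) = (\<Sum>i\<in>UNIV. of_real (l i * log 2 (l i)))"
    by (simp add: trace_orthonormal_basis[OF b] cinner_scale_right orthonormal_basis_cinner[OF b])
  then show ?thesis
    unfolding von_neumann_entropy_def by simp
qed

text \<open>In the expansion of \<open>A *v b i\<close> only the coefficient along
  \<open>b i\<close> survives, and it is real because \<open>A\<close> is Hermitian.\<close>

lemma diagonal_in_eigenbasis: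
  assumes b: "orthonormal_basis b" and "hermitian A" and "diagonal_in b A"
  shows "A *v b i = of_real (Re (cinner (b i) (A *v b i))) *s b i"
proof -
  have "A *v b i = (\<Sum>k\<in>UNIV. cinner (b k) (A *v b i) *s b k)"
    by (simp only: orthonormal_basis_expansion[OF b])
  also have "\<dots> = (\<Sum>k\<in>UNIV. if k = i then cinner (b k) (A *v b i) *s b k else 0)"
    using assms(3) by (intro sum.cong) (auto simp: diagonal_in_def)
  also have "\<dots> = cinner (b i) (A *v b i) *s b i" by simp
  finally show ?thesis
    by (simp only: cinner_hermitian_real[OF assms(2), symmetric])
qed

subsection \<open>Positive semidefinite matrices\<close>

text \<open>Positivity is separated from the trace condition of \<open>density_matrix\<close>
  because the induction below subtracts rank-one pieces, which changes the trace.\<close>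

definition psd :: "complex ^ 'm ^ 'm::finite \<Rightarrow> bool" where
  "psd A \<longleftrightarrow> hermitian A \<and> (\<forall>v. 0 \<le> Re (cinner v (A *v v)))"

lemma psd_hermitian: "psd A \<Longrightarrow> hermitian A"
  and psd_nonneg: "psd A \<Longrightarrow> 0 \<le> Re (cinner v (A *v v))"
  by (simp_all add: psd_def)

lemma density_matrix_iff_psd: "density_matrix A \<longleftrightarrow> psd A \<and> trace A = 1"
  by (simp add: density_matrix_def psd_def)

text \<open>The form of \<open>A\<close> may be degenerate, so the argument is the classical one
  with a nonnegative real quadratic in \<open>t\<close>, with the case of a vanishing leading
  coefficient treated apart.\<close>

lemma psd_Cauchy_Schwarz:
  assumes "psd A"
  shows "(cmod (cinner v (A *v w)))\<^sup>2 \<le> Re (cinner v (A *v v)) * Re (cinner w (A *v w))"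
proof -
  define \<alpha> \<beta> \<gamma> g where "\<alpha> = Re (cinner v (A *v v))" and "\<beta> = Re (cinner w (A *v w))"
    and "\<gamma> = cinner v (A *v w)" and "g = (cmod \<gamma>)\<^sup>2"
  have gg: "\<gamma> * cnj \<gamma> = of_real g"
    by (simp only: g_def complex_norm_square)
  have \<gamma>': "cinner w (A *v v) = cnj \<gamma>"
    by (simp only: \<gamma>_def cnj_cinner cinner_hermitian[OF psd_hermitian[OF assms]])
  have \<alpha>': "cinner v (A *v v) = of_real \<alpha>" and \<beta>': "cinner w (A *v w) = of_real \<beta>"
    unfolding \<alpha>_def \<beta>_def using cinner_hermitian_real[OF psd_hermitian[OF assms]] by blast+
  have quad: "0 \<le> t\<^sup>2 * g * \<alpha> - 2 * t * g + \<beta>" for t :: real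
  proof -
    \<comment> \<open>The factor \<open>\<gamma>\<close> aligns the phases: both cross terms become
      the real number \<open>t * g\<close>.\<close>
    define x where "x = (of_real t * \<gamma>) *s v - w"
    have "cinner x (A *v x) = of_real (t\<^sup>2) * (\<gamma> * cnj \<gamma>) * of_real \<alpha> -
        of_real (2 * t) * (\<gamma> * cnj \<gamma>) + of_real \<beta>"
      unfolding x_def matrix_vector_mult_diff_distrib matrix_vector_mult_scale cinner_diff_left
        cinner_diff_right cinner_scale_left cinner_scale_right \<alpha>' \<beta>' \<gamma>' \<gamma>_def[symmetric]
      by (simp add: algebra_simps power2_eq_square)
    also have "\<dots> = of_real (t\<^sup>2 * g * \<alpha> - 2 * t * g + \<beta>)"
      by (simp add: gg)
    finally show ?thesis
      using psd_nonneg[OF assms, of x] by simp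
  qed
  have "g \<le> \<alpha> * \<beta>"
  proof (cases "\<alpha> = 0")
    case True
    \<comment> \<open>The quadratic is now linear in \<open>t\<close>; at the chosen
      \<open>t\<close> it would equal -1 unless \<open>g = 0\<close>.\<close>
    then show ?thesis
      using quad[of "(\<beta> + 1) / (2 * g)"] by (cases "g = 0") auto
  next
    case False
    then have "\<alpha> > 0"
      using psd_nonneg[OF assms, of v] by (simp add: \<alpha>_def)
    \<comment> \<open>At \<open>t = 1 / \<alpha>\<close> the quadratic equals
      \<open>\<beta> - g / \<alpha>\<close>.\<close>
    then show ?thesis
      using quad[of "1 / \<alpha>"] by (simp add: power2_eq_square field_simps)
  qed
  then show ?thesis by (simp add: g_def \<alpha>_def \<beta>_def \<gamma>_def)
qed

text \<open>Cauchy-Schwarz bounds each squared entry by the product of two diagonal entries, and the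
  double sum of these products factors into the square of the trace.\<close>

lemma psd_Frobenius_le_trace:
  assumes "psd A" and "orthonormal_basis b"
  shows "(\<Sum>k\<in>UNIV. \<Sum>l\<in>UNIV. (cmod (cinner (b k) (A *v b l)))\<^sup>2) \<le> (Re (trace A))\<^sup>2"
proof -
  let ?a = "\<lambda>k. Re (cinner (b k) (A *v b k))"
  have "(\<Sum>k\<in>UNIV. \<Sum>l\<in>UNIV. (cmod (cinner (b k) (A *v b l)))\<^sup>2) \<le>
      (\<Sum>k\<in>UNIV. \<Sum>l\<in>UNIV. ?a k * ?a l)"
    by (intro sum_mono psd_Cauchy_Schwarz assms)
  also have "\<dots> = (\<Sum>k\<in>UNIV. ?a k)\<^sup>2"
    by (simp add: power2_eq_square sum_product)
  also have "(\<Sum>k\<in>UNIV. ?a k) = Re (trace A)"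
    by (simp add: trace_orthonormal_basis[OF assms(2)])
  finally show ?thesis .
qed

text \<open>In particular a vanishing diagonal forces the whole matrix to vanish, which is the base
  of the induction below.\<close>

lemma psd_entry_le: "psd A \<Longrightarrow> (cmod (A $ i $ j))\<^sup>2 \<le> Re (A $ i $ i) * Re (A $ j $ j)"
  using psd_Cauchy_Schwarz[of A "axis i 1" "axis j 1"] by (simp add: cinner_axis_mult_axis)

lemma psd_diagonal_nonneg: "psd A \<Longrightarrow> 0 \<le> Re (A $ i $ i)"
  using psd_nonneg[of A "axis i 1"] by (simp add: cinner_axis_mult_axis)

text \<open>With \<open>u\<close> the rescaled column \<open>k\<close>, the subtracted form at
  \<open>v\<close> is the squared modulus of \<open>cinner (axis k 1) (A *v v)\<close> divided by
  the pivot. Cauchy-Schwarz keeps this below the form of \<open>A\<close>.\<close>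

lemma psd_Schur_complement:
  fixes A :: "complex ^ 'm ^ 'm::finite"
  assumes A: "psd A" and k: "0 < Re (A $ k $ k)"
  defines "u \<equiv> of_real (1 / sqrt (Re (A $ k $ k))) *s (A *v axis k 1)"
  shows "psd (A - outer u u)"
proof -
  let ?r = "Re (A $ k $ k)"
  have "hermitian (A - outer u u)"
    by (simp add: hermitian_def hermitian_cnj[OF psd_hermitian[OF A]]
        hermitian_cnj[OF hermitian_outer])
  moreover have "0 \<le> Re (cinner v ((A - outer u u) *v v))" for v
  proof -
    have "cinner u v = of_real (1 / sqrt ?r) * cinner (axis k 1) (A *v v)"
      unfolding u_def cinner_scale_left cinner_hermitian[OF psd_hermitian[OF A]] by simp
    then have "(cmod (cinner u v))\<^sup>2 = (cmod (cinner (axis k 1) (A *v v)))\<^sup>2 / ?r"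
      using k by (simp add: norm_mult power_mult_distrib norm_divide power_divide)
    also have "\<dots> \<le> Re (cinner v (A *v v))"
      using psd_Cauchy_Schwarz[OF A, of "axis k 1" v] k
      by (simp add: cinner_axis_mult_axis field_simps)
    finally show ?thesis
      by (simp only: matrix_vector_mult_diff_rdistrib cinner_diff_right cinner_outer
          minus_complex.sel Re_complex_of_real diff_ge_0_iff_ge)
  qed
  ultimately show ?thesis by (simp add: psd_def)
qed

text \<open>Each Schur complement kills a diagonal entry and creates no new nonzero one.\<close>

lemma psd_induct [consumes 1, case_names zero add]:
  fixes A :: "complex ^ 'm ^ 'm::finite"
  assumes "psd A" and zero: "P 0"
    and add: "\<And>A u. psd A \<Longrightarrow> P A \<Longrightarrow> P (A + outer u u)"
  shows "P A"
  using \<open>psd A\<close>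
proof (induction "card {k. Re (A $ k $ k) \<noteq> 0}" arbitrary: A rule: less_induct)
  case less
  show ?case
  proof (cases "\<exists>k. Re (A $ k $ k) \<noteq> 0")
    case False
    then have "A = 0"
      using psd_entry_le[OF less.prems] by (simp add: vec_eq_iff)
    then show ?thesis using zero by simp
  next
    case True
    then obtain k where k: "Re (A $ k $ k) \<noteq> 0" by blast
    then have pos: "0 < Re (A $ k $ k)"
      using psd_diagonal_nonneg[OF less.prems, of k] by simp
    define u where "u = of_real (1 / sqrt (Re (A $ k $ k))) *s (A *v axis k 1)"
    define B where "B = A - outer u u"
    have B: "psd B"
      unfolding B_def u_def by (rule psd_Schur_complement[OF less.prems pos])
    have diag: "Re (B $ j $ j) = Re (A $ j $ j) - (cmod (u $ j))\<^sup>2" for j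
    proof -
      have "outer u u $ j $ j = of_real ((cmod (u $ j))\<^sup>2)"
        unfolding outer_def vec_lambda_beta complex_norm_square ..
      then show ?thesis by (simp add: B_def)
    qed
    have "cmod (A $ k $ k) = Re (A $ k $ k)"
    proof -
      have "A $ k $ k = of_real (Re (A $ k $ k))"
        using cinner_hermitian_real[OF psd_hermitian[OF less.prems], of "axis k 1"]
        by (simp only: cinner_axis_mult_axis)
      then show ?thesis
        using pos by (metis abs_of_pos norm_of_real)
    qed
    then have "(cmod (u $ k))\<^sup>2 = Re (A $ k $ k)"
      using pos
      by (simp add: u_def matrix_vector_mult_axis norm_mult norm_divide power_mult_distrib
          power_divide power2_eq_square)
    then have "Re (B $ k $ k) = 0"
      by (simp add: diag)
    \<comment> \<open>A zero diagonal entry stays zero: a square is subtracted from it, yet the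
      result is nonnegative because \<open>B\<close> is positive semidefinite.\<close>
    moreover have "Re (B $ j $ j) = 0" if "Re (A $ j $ j) = 0" for j
      using psd_diagonal_nonneg[OF B, of j] that diag[of j] by simp
    ultimately have "{j. Re (B $ j $ j) \<noteq> 0} \<subset> {j. Re (A $ j $ j) \<noteq> 0}"
      using k by blast
    then have "P B"
      by (intro less.hyps[OF _ B] psubset_card_mono) auto
    then have "P (B + outer u u)"
      using add B by blast
    then show ?thesis by (simp add: B_def)
  qed
qed

subsection \<open>Tensor products\<close>

lemma sum_UNIV_prod:
  "(\<Sum>p\<in>(UNIV :: ('a::finite \<times> 'b::finite) set). f p) = (\<Sum>i\<in>UNIV. \<Sum>j\<in>UNIV. f (i, j))"
  by (simp add: sum.cartesian_product)

lemma tensor_mat_zero_left: "tensor_mat 0 B = 0"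
  by (simp add: tensor_mat_def vec_eq_iff)

lemma tensor_mat_add_left: "tensor_mat (A + A') B = tensor_mat A B + tensor_mat A' B"
  by (simp add: tensor_mat_def vec_eq_iff algebra_simps)

lemma trace_tensor_mat: "trace (tensor_mat A B) = trace A * trace B"
  by (simp add: trace_def tensor_mat_def sum_UNIV_prod sum_product)

lemma hermitian_tensor_mat:
  assumes "hermitian A" and "hermitian B"
  shows "hermitian (tensor_mat A B)"
  unfolding hermitian_def tensor_mat_def
  by (simp add: hermitian_cnj[OF assms(1)] hermitian_cnj[OF assms(2)])

lemma tensor_mat_mult_tensor_vec:
  "tensor_mat A B *v tensor_vec v w = tensor_vec (A *v v) (B *v w)"
  by (simp add: vec_eq_iff tensor_mat_def tensor_vec_def matrix_vector_mult_def sum_UNIV_prod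
      sum_product algebra_simps)

lemma cinner_tensor_vec: "cinner (tensor_vec v w) (tensor_vec x y) = cinner v x * cinner w y"
  by (simp add: tensor_vec_def cinner_def sum_UNIV_prod sum_product algebra_simps)

text \<open>Here \<open>w v\<close> is the partial inner product of \<open>v\<close> with
  \<open>u\<close> over the first factor. Positivity of a tensor product with rank-one left factor
  thereby reduces to positivity of \<open>B\<close>.\<close>

lemma cinner_tensor_mat_outer:
  fixes u :: "complex ^ 'n::finite"
  defines "w \<equiv> \<lambda>v. \<chi> j. \<Sum>i\<in>UNIV. cnj (u $ i) * v $ (i, j)"
  shows "cinner v (tensor_mat (outer u u) B *v v) = cinner (w v) (B *v w v)"
proof -
  define y where "y = B *v w v"
  have w: "w v $ j = (\<Sum>i\<in>UNIV. cnj (u $ i) * v $ (i, j))" for j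
    by (simp add: w_def)
  have "(tensor_mat (outer u u) B *v v) $ (i, j) = u $ i * y $ j" for i j
  proof -
    have "(tensor_mat (outer u u) B *v v) $ (i, j) =
        (\<Sum>k\<in>UNIV. \<Sum>l\<in>UNIV. u $ i * cnj (u $ k) * B $ j $ l * v $ (k, l))"
      by (simp add: matrix_vector_mult_def tensor_mat_def outer_def sum_UNIV_prod)
    also have "\<dots> = (\<Sum>l\<in>UNIV. \<Sum>k\<in>UNIV. u $ i * cnj (u $ k) * B $ j $ l * v $ (k, l))"
      by (rule sum.swap)
    also have "\<dots> = u $ i * y $ j"
      by (simp add: y_def w matrix_vector_mult_def sum_distrib_left ac_simps)
    finally show ?thesis .
  qed
  then have "cinner v (tensor_mat (outer u u) B *v v) =
      (\<Sum>i\<in>UNIV. \<Sum>j\<in>UNIV. cnj (v $ (i, j)) * (u $ i * y $ j))"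
    by (simp add: cinner_def sum_UNIV_prod)
  also have "\<dots> = (\<Sum>j\<in>UNIV. \<Sum>i\<in>UNIV. cnj (v $ (i, j)) * (u $ i * y $ j))"
    by (rule sum.swap)
  also have "\<dots> = cinner (w v) y"
    by (simp add: cinner_def w sum_distrib_left sum_distrib_right ac_simps)
  finally show ?thesis by (simp add: y_def)
qed

text \<open>The tensor product is additive in its left factor, so building \<open>A\<close> up from
  rank-one pieces by \<open>psd_induct\<close> suffices; no diagonalization of \<open>A\<close>
  enters.\<close>

lemma psd_tensor_mat:
  assumes "psd A" and "psd B"
  shows "psd (tensor_mat A B)"
proof -
  have "0 \<le> Re (cinner v (tensor_mat A B *v v))" for v
    using \<open>psd A\<close>
  proof (induction rule: psd_induct)
    case zero
    then show ?case by (simp add: tensor_mat_zero_left)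
  next
    case (add A u)
    then show ?case
      using psd_nonneg[OF \<open>psd B\<close>]
      by (simp add: tensor_mat_add_left matrix_vector_mult_add_rdistrib cinner_add_right
          cinner_tensor_mat_outer)
  qed
  then show ?thesis
    using assms by (simp add: psd_def hermitian_tensor_mat)
qed

lemma density_matrix_tensor_mat:
  "density_matrix A \<Longrightarrow> density_matrix B \<Longrightarrow> density_matrix (tensor_mat A B)"
  by (simp add: density_matrix_iff_psd psd_tensor_mat trace_tensor_mat)

subsection \<open>Klein entropy of a measurement\<close>

text \<open>Since \<open>P i\<close> is idempotent and the trace is cyclic, the probability is the
  trace of \<open>P i ** (\<rho> ** P i)\<close>, a sum of values of the form of
  \<open>\<rho>\<close> at the vectors \<open>P i *v axis k 1\<close>.\<close>

lemma measurement_probability_nonneg: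
  assumes "psd \<rho>" and P: "von_neumann_measurement P"
  shows "0 \<le> Re (trace (\<rho> ** P i))"
proof -
  have h: "hermitian (P i)" and "P i ** P i = P i"
    using P by (auto simp: von_neumann_measurement_def)
  then have "trace (\<rho> ** P i) = trace ((\<rho> ** P i) ** P i)"
    by (simp add: matrix_mul_assoc[symmetric])
  also have "\<dots> = trace (P i ** (\<rho> ** P i))"
    by (rule trace_mul_sym)
  also have "\<dots> = (\<Sum>k\<in>UNIV. cinner (P i *v axis k 1) (\<rho> *v (P i *v axis k 1)))"
    by (simp add: trace_orthonormal_basis[OF orthonormal_basis_axis] cinner_hermitian[OF h]
        flip: matrix_vector_mul_assoc)
  finally show ?thesis
    using psd_nonneg[OF \<open>psd \<rho>\<close>] by (simp add: sum_nonneg)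
qed

lemma measurement_probability_sum:
  assumes "trace \<rho> = 1" and "von_neumann_measurement P"
  shows "(\<Sum>i\<in>UNIV. Re (trace (\<rho> ** P i))) = 1"
proof -
  have "(\<Sum>i\<in>UNIV. trace (\<rho> ** P i)) = trace (\<rho> ** (\<Sum>i\<in>UNIV. P i))"
    by (simp add: matrix_mult_sum_right trace_sum)
  also have "\<dots> = 1"
    using assms by (simp add: von_neumann_measurement_def)
  finally have "Re (\<Sum>i\<in>UNIV. trace (\<rho> ** P i)) = 1"
    by simp
  then show ?thesis by simp
qed

text \<open>Replacing every \<open>log 2\<close> of a probability by \<open>log 2 c\<close> can only
  enlarge the sum, and the probabilities add up to 1.\<close>

lemma klein_entropy_lower_bound:
  assumes \<rho>: "density_matrix \<rho>" and P: "von_neumann_measurement P"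
    and c: "\<And>i. Re (trace (\<rho> ** P i)) \<le> c"
  shows "- log 2 c \<le> klein_entropy \<rho> P"
proof -
  let ?p = "\<lambda>i. Re (trace (\<rho> ** P i))"
  have nonneg: "0 \<le> ?p i" for i
    using \<rho> P by (simp add: density_matrix_iff_psd measurement_probability_nonneg)
  have "?p i * log 2 (?p i) \<le> ?p i * log 2 c" for i
  \<comment> \<open>Monotonicity of the logarithm needs a positive argument; at probability 0 both
    products vanish.\<close>
  proof (cases "?p i = 0")
    case False
    then have "0 < ?p i" using nonneg[of i] by simp
    then show ?thesis using c[of i] by (intro mult_left_mono) auto
  qed simp
  then have "(\<Sum>i\<in>UNIV. ?p i * log 2 (?p i)) \<le> (\<Sum>i\<in>UNIV. ?p i * log 2 c)"
    by (intro sum_mono)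
  also have "\<dots> = log 2 c"
    using \<rho> P
    by (simp add: density_matrix_iff_psd measurement_probability_sum flip: sum_distrib_right)
  finally show ?thesis by (simp add: klein_entropy_def)
qed

lemma klein_entropy_nonneg:
  assumes \<rho>: "density_matrix \<rho>" and P: "von_neumann_measurement P"
  shows "0 \<le> klein_entropy \<rho> P"
proof -
  have "Re (trace (\<rho> ** P i)) \<le> 1" for i
  proof -
    have "Re (trace (\<rho> ** P i)) \<le> (\<Sum>i\<in>UNIV. Re (trace (\<rho> ** P i)))"
      using \<rho> P
      by (intro member_le_sum)
        (auto simp: density_matrix_iff_psd intro: measurement_probability_nonneg)
    then show ?thesis
      using \<rho> P by (simp add: density_matrix_iff_psd measurement_probability_sum)
  qed
  from klein_entropy_lower_bound[OF \<rho> P this] show ?thesis by simp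
qed

text \<open>A crude bound from \<open>ln x \<le> x - 1\<close> at \<open>x = 1 / p\<close>.\<close>

lemma neg_mult_log_le:
  fixes p :: real
  assumes "0 \<le> p"
  shows "- (p * log 2 p) \<le> 1 / ln 2"
proof (cases "p = 0")
  case False
  then have "0 < p" using assms by simp
  then have "ln (1 / p) \<le> 1 / p - 1"
    by (intro ln_le_minus_one) simp
  then have "p * (- ln p) \<le> p * (1 / p - 1)"
    using \<open>0 < p\<close> by (intro mult_left_mono) (simp_all add: ln_div)
  also have "\<dots> \<le> 1" using \<open>0 < p\<close> by (simp add: algebra_simps)
  finally have "- (p * ln p) / ln 2 \<le> 1 / ln 2"
    by (intro divide_right_mono) auto
  then show ?thesis by (simp add: log_def)
qed simp

text \<open>The bound is not sharp; it has to be uniform in \<open>P\<close> so that the supremum in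
  \<open>entropic_entanglement\<close> ranges over a set bounded above.\<close>

lemma klein_entropy_upper_bound:
  fixes \<rho> :: "complex ^ 'm ^ 'm::finite"
  assumes "density_matrix \<rho>" and "von_neumann_measurement P"
  shows "klein_entropy \<rho> P \<le> real CARD('m) / ln 2"
proof -
  let ?p = "\<lambda>i. Re (trace (\<rho> ** P i))"
  have "klein_entropy \<rho> P = (\<Sum>i\<in>UNIV. - (?p i * log 2 (?p i)))"
    by (simp add: klein_entropy_def sum_negf)
  also have "\<dots> \<le> (\<Sum>i\<in>(UNIV :: 'm set). 1 / ln 2)"
    using assms
    by (intro sum_mono neg_mult_log_le measurement_probability_nonneg)
      (simp_all add: density_matrix_iff_psd)
  finally show ?thesis by simp
qed

section \<open>Product states and lower bounds on the entanglement parameter\<close>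

lemma product_state_density_matrix: "\<delta> \<in> product_states \<Longrightarrow> density_matrix \<delta>"
  by (auto simp: product_states_def density_matrix_tensor_mat)

lemma psd_outer: "psd (outer v v)"
  by (simp add: psd_def hermitian_outer cinner_outer)

lemma product_states_nonempty:
  "(product_states :: (complex ^ ('n \<times> 'n) ^ ('n::finite \<times> 'n)) set) \<noteq> {}"
proof -
  fix k :: 'n
  \<comment> \<open>The factor \<open>mat 1\<close> brings the trace into the shape of
    \<open>trace_mult_outer\<close>.\<close>
  have "trace (mat 1 ** outer (axis k 1) (axis k 1) :: complex ^ 'n ^ 'n) = 1"
    unfolding trace_mult_outer cinner_axis_mult_axis by (simp add: mat_def)
  then have "density_matrix (outer (axis k 1) (axis k 1) :: complex ^ 'n ^ 'n)"
    by (simp add: density_matrix_iff_psd psd_outer)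
  then show ?thesis
    unfolding product_states_def by blast
qed

text \<open>A single measurement bounds the supremum from below. On the reals this requires the set
  under the supremum to be bounded above, and bounding the infimum from below requires a nonempty
  set of product states.\<close>

lemma entropic_entanglement_ge:
  assumes \<rho>: "density_matrix \<rho>" and P: "von_neumann_measurement P"
    and c: "\<And>\<delta>. \<delta> \<in> product_states \<Longrightarrow> c \<le> klein_entropy \<delta> P"
  shows "c - klein_entropy \<rho> P \<le> entropic_entanglement \<rho>"
proof -
  obtain \<delta>0 :: "complex ^ ('a \<times> 'a) ^ ('a \<times> 'a)" where \<delta>0: "\<delta>0 \<in> product_states"
    using product_states_nonempty by blast
  let ?F = "\<lambda>P. (INF \<delta>\<in>product_states. klein_entropy \<delta> P) - klein_entropy \<rho> P"
  have "c - klein_entropy \<rho> P \<le> ?F P"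
    using c by (simp add: cINF_greatest product_states_nonempty)
  also have "?F P \<le> (SUP P\<in>{P. von_neumann_measurement P}. ?F P)"
  proof (rule cSUP_upper)
    \<comment> \<open>For each \<open>Q\<close> the infimum is at most the entropy of the fixed
      state \<open>\<delta>0\<close>, which is bounded independently of \<open>Q\<close>, and the
      subtracted entropy is nonnegative.\<close>
    show "bdd_above (?F ` {P. von_neumann_measurement P})"
    proof (rule bdd_aboveI2)
      fix Q :: "'a \<times> 'a \<Rightarrow> complex ^ ('a \<times> 'a) ^ ('a \<times> 'a)"
      assume "Q \<in> {P. von_neumann_measurement P}"
      then have Q: "von_neumann_measurement Q" by simp
      have "bdd_below ((\<lambda>\<delta>. klein_entropy \<delta> Q) ` product_states)"
        using Q by (intro bdd_belowI2[of _ 0] klein_entropy_nonneg product_state_density_matrix)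
      then have "(INF \<delta>\<in>product_states. klein_entropy \<delta> Q) \<le> klein_entropy \<delta>0 Q"
        using \<delta>0 by (rule cINF_lower)
      also have "\<dots> \<le> real CARD('a \<times> 'a) / ln 2"
        using \<delta>0 Q by (intro klein_entropy_upper_bound product_state_density_matrix)
      finally show "?F Q \<le> real CARD('a \<times> 'a) / ln 2"
        using klein_entropy_nonneg[OF \<rho> Q] by simp
    qed
  qed (use P in simp)
  finally show ?thesis by (simp add: entropic_entanglement_def)
qed

section \<open>The measurement given by an orthonormal basis\<close>

text \<open>Every row is a multiple of the conjugate of \<open>v\<close>, and some multiple is
  nonzero, so the row space is a line.\<close>

lemma rank_outer:
  assumes "v \<noteq> 0"
  shows "rank (outer v v) = 1"
proof -
  let ?w = "\<chi> j. cnj (v $ j)"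
  obtain i where i: "v $ i \<noteq> 0"
    using assms by (auto simp: vec_eq_iff)
  have row: "row k (outer v v) = v $ k *s ?w" for k
    by (simp add: row_def outer_def vec_eq_iff)
  have "vec.span (rows (outer v v)) = vec.span {?w}"
  proof (rule vec.span_eq[THEN iffD2], intro conjI subsetI)
    fix x
    assume "x \<in> rows (outer v v)"
    then show "x \<in> vec.span {?w}"
      unfolding rows_def row by (auto intro: vec.span_scale vec.span_base)
  next
    fix x
    assume "x \<in> {?w}"
    then have "x = inverse (v $ i) *s row i (outer v v)"
      unfolding row using i by (simp add: vec_eq_iff)
    moreover have "row i (outer v v) \<in> rows (outer v v)"
      by (auto simp: rows_def)
    ultimately show "x \<in> vec.span (rows (outer v v))"
      by (simp only: vec.span_scale vec.span_base)
  qed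
  moreover have "?w \<noteq> 0"
    using i by (auto simp: vec_eq_iff)
  ultimately show ?thesis
    unfolding row_rank_def_gen
    by (metis vec.dim_span vec.dim_insert vec.dim_eq_card_independent vec.independent_insert
        vec.dim_singleton)
qed

lemma von_neumann_measurement_basis:
  assumes b: "orthonormal_basis b"
  shows "von_neumann_measurement (\<lambda>i. outer (b i) (b i))"
proof -
  have "b i \<noteq> 0" for i
    using orthonormal_basis_cinner[OF b, of i i] by auto
  moreover have "outer (b i) (b i) ** outer (b j) (b j) = (if i = j then outer (b i) (b i) else 0)"
    for i j
    by (simp add: outer_mult_outer orthonormal_basis_cinner[OF b] vec_eq_iff)
  ultimately show ?thesis
    by (simp add: von_neumann_measurement_def hermitian_outer rank_outer
        sum_outer_orthonormal_basis[OF b])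
qed

subsection \<open>Maximally entangled vectors\<close>

text \<open>The arithmetic-geometric mean inequality, applied to each pair \<open>k\<close>,
  \<open>l\<close>, bounds the sum of products by the mean of two squared Frobenius norms, each at
  most 1 for matrices of trace 1.\<close>

lemma maximally_entangled_overlap_le:
  fixes \<psi> :: "complex ^ ('n::finite \<times> 'n)"
  assumes "maximally_entangled \<psi>" and A: "density_matrix A" and B: "density_matrix B"
  shows "Re (cinner \<psi> (tensor_mat A B *v \<psi>)) \<le> 1 / real CARD('n)"
proof -
  let ?s = "complex_of_real (1 / sqrt (real CARD('n)))"
  obtain e f where e: "orthonormal_basis e" and f: "orthonormal_basis f"
    and \<psi>: "\<psi> = (\<Sum>i\<in>UNIV. ?s *s tensor_vec (e i) (f i))"
    using assms(1) by (auto simp: maximally_entangled_def schmidt_decomposition_def)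
  let ?a = "\<lambda>k l. cinner (e k) (A *v e l)" and ?b = "\<lambda>k l. cinner (f k) (B *v f l)"
  have s: "cnj ?s * ?s = of_real (1 / real CARD('n))"
    by (simp flip: of_real_mult)
  have "cinner \<psi> (tensor_mat A B *v \<psi>) =
      (\<Sum>l\<in>UNIV. \<Sum>k\<in>UNIV. (cnj ?s * ?s) * (?a k l * ?b k l))"
    unfolding \<psi> matrix_vector_mult_sum_right matrix_vector_mult_scale tensor_mat_mult_tensor_vec
      cinner_sum_left cinner_sum_right cinner_scale_left cinner_scale_right cinner_tensor_vec
    by (simp only: sum_distrib_left ac_simps)
  also have "\<dots> = (\<Sum>k\<in>UNIV. \<Sum>l\<in>UNIV. (cnj ?s * ?s) * (?a k l * ?b k l))"
    by (rule sum.swap)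
  also have "\<dots> = of_real (1 / real CARD('n)) * (\<Sum>k\<in>UNIV. \<Sum>l\<in>UNIV. ?a k l * ?b k l)"
    unfolding s by (simp only: sum_distrib_left)
  finally have "Re (cinner \<psi> (tensor_mat A B *v \<psi>)) =
      (\<Sum>k\<in>UNIV. \<Sum>l\<in>UNIV. Re (?a k l * ?b k l)) / real CARD('n)"
    by simp
  also have "(\<Sum>k\<in>UNIV. \<Sum>l\<in>UNIV. Re (?a k l * ?b k l)) \<le>
      (\<Sum>k\<in>UNIV. \<Sum>l\<in>UNIV. ((cmod (?a k l))\<^sup>2 + (cmod (?b k l))\<^sup>2) / 2)"
  proof (intro sum_mono)
    fix k l
    have "Re (?a k l * ?b k l) \<le> cmod (?a k l) * cmod (?b k l)"
      by (metis complex_Re_le_cmod norm_mult)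
    also have "\<dots> \<le> ((cmod (?a k l))\<^sup>2 + (cmod (?b k l))\<^sup>2) / 2"
      using sum_squares_bound[of "cmod (?a k l)" "cmod (?b k l)"] by simp
    finally show "Re (?a k l * ?b k l) \<le> ((cmod (?a k l))\<^sup>2 + (cmod (?b k l))\<^sup>2) / 2" .
  qed
  also have "\<dots> = ((\<Sum>k\<in>UNIV. \<Sum>l\<in>UNIV. (cmod (?a k l))\<^sup>2) +
      (\<Sum>k\<in>UNIV. \<Sum>l\<in>UNIV. (cmod (?b k l))\<^sup>2)) / 2"
    by (simp add: sum.distrib flip: sum_divide_distrib)
  also have "\<dots> \<le> 1"
    using psd_Frobenius_le_trace[OF _ e, of A] psd_Frobenius_le_trace[OF _ f, of B] A B
    by (simp add: density_matrix_iff_psd)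
  finally show ?thesis
    by (simp add: divide_right_mono)
qed

section \<open>Marginals of maximally entangled vectors and of states diagonal in them\<close>

text \<open>The inner sums are the entries of the product of the unitary with columns
  \<open>e m\<close> and the transpose of the unitary with columns \<open>f m\<close>. The identity
  says that the rows of this unitary product are orthonormal.\<close>

lemma orthonormal_bases_contraction:
  fixes e f :: "'n::finite \<Rightarrow> complex ^ 'n"
  assumes e: "orthonormal_basis e" and f: "orthonormal_basis f"
  shows "(\<Sum>k\<in>UNIV. (\<Sum>m\<in>UNIV. e m $ i * f m $ k) * cnj (\<Sum>m\<in>UNIV. e m $ j * f m $ k)) =
    (if i = j then 1 else 0)"
proof -
  have "(\<Sum>k\<in>UNIV. (\<Sum>m\<in>UNIV. e m $ i * f m $ k) * cnj (\<Sum>m\<in>UNIV. e m $ j * f m $ k)) =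
      (\<Sum>k\<in>UNIV. \<Sum>m\<in>UNIV. \<Sum>l\<in>UNIV. (e m $ i * cnj (e l $ j)) * (cnj (f l $ k) * f m $ k))"
    by (simp add: sum_product ac_simps)
  also have "\<dots> = (\<Sum>m\<in>UNIV. \<Sum>k\<in>UNIV. \<Sum>l\<in>UNIV.
      (e m $ i * cnj (e l $ j)) * (cnj (f l $ k) * f m $ k))"
    by (rule sum.swap)
  also have "\<dots> = (\<Sum>m\<in>UNIV. \<Sum>l\<in>UNIV. \<Sum>k\<in>UNIV.
      (e m $ i * cnj (e l $ j)) * (cnj (f l $ k) * f m $ k))"
    by (intro sum.cong refl sum.swap)
  also have "\<dots> = (\<Sum>m\<in>UNIV. \<Sum>l\<in>UNIV. (e m $ i * cnj (e l $ j)) * cinner (f l) (f m))"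
    by (simp only: cinner_def sum_distrib_left)
  also have "\<dots> = (\<Sum>m\<in>UNIV. \<Sum>l\<in>UNIV. if l = m then e m $ i * cnj (e l $ j) else 0)"
    by (intro sum.cong refl) (simp add: orthonormal_basis_cinner[OF f])
  also have "\<dots> = (if i = j then 1 else 0)"
    by (simp add: orthonormal_basis_completeness[OF e])
  finally show ?thesis .
qed

text \<open>Arranged as a matrix, the coordinates of \<open>\<psi>\<close> form a unitary divided by
  the square root of the dimension; the two sums are the entries of the two marginals of
  \<open>outer \<psi> \<psi>\<close>.\<close>

lemma maximally_entangled_marginals:
  fixes \<psi> :: "complex ^ ('n::finite \<times> 'n)"
  assumes "maximally_entangled \<psi>"
  shows "(\<Sum>k\<in>UNIV. \<psi> $ (i, k) * cnj (\<psi> $ (j, k))) = (if i = j then 1 / of_nat CARD('n) else 0)"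
    and "(\<Sum>k\<in>UNIV. \<psi> $ (k, i) * cnj (\<psi> $ (k, j))) = (if i = j then 1 / of_nat CARD('n) else 0)"
proof -
  let ?s = "complex_of_real (1 / sqrt (real CARD('n)))"
  obtain e f where e: "orthonormal_basis e" and f: "orthonormal_basis f"
    and "\<psi> = (\<Sum>i\<in>UNIV. ?s *s tensor_vec (e i) (f i))"
    using assms by (auto simp: maximally_entangled_def schmidt_decomposition_def)
  then have \<psi>: "\<psi> $ (i, k) = ?s * (\<Sum>m\<in>UNIV. e m $ i * f m $ k)" for i k
    by (simp add: tensor_vec_def sum_distrib_left del: of_real_divide)
  have s: "?s * cnj ?s = 1 / of_nat CARD('n)"
    by (simp flip: of_real_mult)
  have *: "(?s * x) * cnj (?s * y) = (?s * cnj ?s) * (x * cnj y)" for x y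
    by (simp only: complex_cnj_mult ac_simps)
  show "(\<Sum>k\<in>UNIV. \<psi> $ (i, k) * cnj (\<psi> $ (j, k))) = (if i = j then 1 / of_nat CARD('n) else 0)"
    unfolding \<psi> * s sum_distrib_left[symmetric] orthonormal_bases_contraction[OF e f] by simp
  \<comment> \<open>Exchanging the tensor factors exchanges \<open>e\<close> and \<open>f\<close>,
    so the contraction lemma applies again.\<close>
  have \<psi>': "\<psi> $ (k, i) = ?s * (\<Sum>m\<in>UNIV. f m $ i * e m $ k)" for i k
    unfolding \<psi> by (simp only: mult.commute)
  show "(\<Sum>k\<in>UNIV. \<psi> $ (k, i) * cnj (\<psi> $ (k, j))) = (if i = j then 1 / of_nat CARD('n) else 0)"
    unfolding \<psi>' * s sum_distrib_left[symmetric] orthonormal_bases_contraction[OF f e] by simp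
qed

lemma von_neumann_entropy_maximally_mixed:
  "von_neumann_entropy (mat (1 / of_nat CARD('n)) :: complex ^ 'n ^ 'n::finite) =
    log 2 (real CARD('n))"
proof -
  have "(mat (1 / of_nat CARD('n)) :: complex ^ 'n ^ 'n) *v axis i 1 =
      of_real (1 / real CARD('n)) *s axis i 1" for i
    by (simp add: vec_eq_iff matrix_vector_mult_axis) (simp add: mat_def axis_def)
  from von_neumann_entropy_eigenbasis[OF orthonormal_basis_axis this] show ?thesis
    by (simp add: log_divide)
qed

text \<open>Spectral decomposition makes each marginal of \<open>\<rho>\<close> the sum of the
  marginals of the \<open>b m\<close> with weights \<open>l m\<close>. These marginals coincide, and
  the weights sum to the trace.\<close>

lemma reduced_states_maximally_entangled_basis:
  fixes \<rho> :: "complex ^ ('n \<times> 'n) ^ ('n::finite \<times> 'n)"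
  assumes b: "maximally_entangled_basis b" and "trace \<rho> = 1"
    and eig: "\<And>i. \<rho> *v b i = of_real (l i) *s b i"
  shows "reduced_A \<rho> = mat (1 / of_nat CARD('n))" and "reduced_B \<rho> = mat (1 / of_nat CARD('n))"
proof -
  have ob: "orthonormal_basis b" and me: "\<And>i. maximally_entangled (b i)"
    using b by (auto simp: maximally_entangled_basis_def)
  have "\<rho> = (\<Sum>m\<in>UNIV. outer (of_real (l m) *s b m) (b m))"
  proof (rule matrix_eqI_on_orthonormal_basis[OF ob])
    fix i
    have "(\<Sum>m\<in>UNIV. outer (of_real (l m) *s b m) (b m)) *v b i =
        (\<Sum>m\<in>UNIV. if m = i then of_real (l m) *s b m else 0)"
      unfolding matrix_vector_mult_sum_left outer_mult_vector
      by (intro sum.cong refl) (simp add: orthonormal_basis_cinner[OF ob])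
    then show "\<rho> *v b i = (\<Sum>m\<in>UNIV. outer (of_real (l m) *s b m) (b m)) *v b i"
      by (simp add: eig)
  qed
  then have \<rho>: "\<rho> $ p $ q = (\<Sum>m\<in>UNIV. of_real (l m) * (b m $ p * cnj (b m $ q)))" for p q
    by (simp add: outer_def ac_simps)
  have "trace \<rho> = (\<Sum>m\<in>UNIV. of_real (l m))"
    by (simp add: trace_orthonormal_basis[OF ob] eig cinner_scale_right
        orthonormal_basis_cinner[OF ob])
  then have l: "(\<Sum>m\<in>UNIV. complex_of_real (l m)) = 1"
    using \<open>trace \<rho> = 1\<close> by simp
  have "reduced_A \<rho> $ i $ j =
      (\<Sum>m\<in>UNIV. \<Sum>k\<in>UNIV. of_real (l m) * (b m $ (i, k) * cnj (b m $ (j, k))))" for i j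
    unfolding reduced_A_def \<rho> vec_lambda_beta by (rule sum.swap)
  then show "reduced_A \<rho> = mat (1 / of_nat CARD('n))"
    by (simp only: sum_distrib_left[symmetric] maximally_entangled_marginals[OF me]
        sum_distrib_right[symmetric] l vec_eq_iff) (simp add: mat_def)
  have "reduced_B \<rho> $ i $ j =
      (\<Sum>m\<in>UNIV. \<Sum>k\<in>UNIV. of_real (l m) * (b m $ (k, i) * cnj (b m $ (k, j))))" for i j
    unfolding reduced_B_def \<rho> vec_lambda_beta by (rule sum.swap)
  then show "reduced_B \<rho> = mat (1 / of_nat CARD('n))"
    by (simp only: sum_distrib_left[symmetric] maximally_entangled_marginals[OF me]
        sum_distrib_right[symmetric] l vec_eq_iff) (simp add: mat_def)
qed

theorem proposition6:
  fixes \<rho> :: "complex ^ ('n \<times> 'n) ^ ('n::finite \<times> 'n)"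
    and b :: "'n \<times> 'n \<Rightarrow> complex ^ ('n \<times> 'n)"
  assumes "density_matrix \<rho>"
    and "maximally_entangled_basis b"
    and "diagonal_in b \<rho>"
  shows "entropic_entanglement \<rho> \<ge> log 2 (real CARD('n)) - von_neumann_entropy \<rho> \<and>
         log 2 (real CARD('n)) - von_neumann_entropy \<rho> = coherent_information_A \<rho> \<and>
         log 2 (real CARD('n)) - von_neumann_entropy \<rho> = coherent_information_B \<rho>"
proof -
  define P where "P = (\<lambda>i. outer (b i) (b i))"
  define l where "l = (\<lambda>i. Re (cinner (b i) (\<rho> *v b i)))"
  have b: "orthonormal_basis b"
    using assms(2) by (simp add: maximally_entangled_basis_def)
  have P: "von_neumann_measurement P"
    unfolding P_def by (rule von_neumann_measurement_basis[OF b])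
  have eig: "\<rho> *v b i = of_real (l i) *s b i" for i
    unfolding l_def using assms(1,3)
    by (intro diagonal_in_eigenbasis[OF b]) (simp_all add: density_matrix_def)
  \<comment> \<open>The eigenvalue at \<open>b i\<close> and the probability of outcome
    \<open>i\<close> are the same number, so the two entropies agree term by term.\<close>
  have S: "von_neumann_entropy \<rho> = klein_entropy \<rho> P"
    unfolding von_neumann_entropy_eigenbasis[OF b eig] klein_entropy_def P_def trace_mult_outer
      l_def ..
  have "log 2 (real CARD('n)) \<le> klein_entropy \<delta> P" if \<delta>: "\<delta> \<in> product_states" for \<delta>
  proof -
    obtain A B where AB: "\<delta> = tensor_mat A B" "density_matrix A" "density_matrix B"
      using \<delta> by (auto simp: product_states_def)
    have "maximally_entangled (b i)" for i
      using assms(2) by (simp only: maximally_entangled_basis_def)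
    from maximally_entangled_overlap_le[OF this AB(2,3)]
    have "Re (trace (\<delta> ** P i)) \<le> 1 / real CARD('n)" for i
      unfolding AB(1) P_def trace_mult_outer .
    \<comment> \<open>The uniform bound \<open>c = 1 / real CARD('n)\<close> gives
      \<open>- log 2 c = log 2 (real CARD('n))\<close>.\<close>
    from klein_entropy_lower_bound[OF product_state_density_matrix[OF \<delta>] P this]
    show ?thesis by (simp add: log_divide)
  qed
  then have "log 2 (real CARD('n)) - von_neumann_entropy \<rho> \<le> entropic_entanglement \<rho>"
    unfolding S by (rule entropic_entanglement_ge[OF assms(1) P])
  moreover have "trace \<rho> = 1"
    using assms(1) by (simp add: density_matrix_def)
  ultimately show ?thesis
    using reduced_states_maximally_entangled_basis[OF assms(2) _ eig]
    by (simp add: coherent_information_A_def coherent_information_B_def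
        von_neumann_entropy_maximally_mixed)
qed

end
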